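(* If a group $G$ is Cayley polynomial-time computable with quasigeodesic normal form, then the word problem in $G$ can be solved by a deterministic one-tape Turing machine in polynomial time.
   Context: A function $f:\Sigma^*\to\Sigma^*$ is polynomial-time computable if it is computed by a deterministic one-tape Turing machine in time $O(p(n))$, where $p$ is a polynomial and $n$ is the length of the input. Let $G$ be a finitely generated group and $S=\{s_1,\dots,s_n\}\subseteq G$ a finite set of semigroup generators (every $g\in G$ is a product of elements of $S$). A Cayley polynomial-time computable representation of $G$ is a bijection $\psi:L\to G$, where $L\subseteq\Sigma^*$ is a language over a finite alphabet $\Sigma$, for which there exist polynomial-time computable functions $f_i:\Sigma^*\to\Sigma^*$, $i=1,\dots,n$, with $f_i(L)\subseteq L$ and $\psi(f_i(w))=\psi(w)s_i$ for all $w\in L$. This does not depend on the choice of $S$. Let $A$ be a finite generating set of $G$ and let $d_A(g)$ be the length of a shortest word over $A\cup A^{-1}$ representing $g$. A bijection $\psi:L\to G$ has quasigeodesic normal form if there is a constant $C$ such that $|w|\leqslant C(d_A(\psi(w))+1)$ for all $w\in L$. $G$ is Cayley polynomial-time computable with quasigeodesic normal form if it admits a Cayley polynomial-time computable representation which has quasigeodesic normal form. The word problem in $G$: given a word $v\in(A\cup A^{-1})^*$, decide whether $v$ represents the identity of $G$; time is measured in the length of $v$. *)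

theory Defs
  imports
    "HOL-Algebra.Generated_Groups"
    "HOL-Computational_Algebra.Polynomial"
    "HOL-Library.Landau_Symbols"
begin

section \<open>Deterministic one-tape Turing machines\<close>

text \<open>
  Machines have a single tape that is infinite to the right only, with cells numbered
  \<open>0, 1, 2, \<dots>\<close>. States and auxiliary tape symbols are natural numbers, which is no
  restriction because both sets are finite. The constructor \<open>Letter\<close> embeds the input
  alphabet in the tape alphabet, so that input letters are never confused with the blank or
  with auxiliary symbols.
\<close>

datatype 'a tape_symbol = Blank | Letter 'a | Aux nat

datatype direction = MoveLeft | Stay | MoveRight

record 'a tm =
  tm_states :: "nat set"
  tm_aux :: "nat set"
  tm_start :: nat
  tm_accept :: nat
  tm_reject :: nat
  tm_delta :: "nat \<Rightarrow> 'a tape_symbol \<Rightarrow> nat \<times> 'a tape_symbol \<times> direction"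

definition tape_alphabet :: "'a set \<Rightarrow> 'a tm \<Rightarrow> 'a tape_symbol set" where
  "tape_alphabet \<Sigma> M = {Blank} \<union> Letter ` \<Sigma> \<union> Aux ` tm_aux M"

definition turing_machine :: "'a set \<Rightarrow> 'a tm \<Rightarrow> bool" where
  "turing_machine \<Sigma> M \<longleftrightarrow>
     finite \<Sigma> \<and> finite (tm_states M) \<and> finite (tm_aux M) \<and>
     tm_start M \<in> tm_states M \<and> tm_accept M \<in> tm_states M \<and> tm_reject M \<in> tm_states M \<and>
     tm_accept M \<noteq> tm_reject M \<and>
     (\<forall>q \<in> tm_states M - {tm_accept M, tm_reject M}. \<forall>x \<in> tape_alphabet \<Sigma> M.
        tm_delta M q x \<in> tm_states M \<times> tape_alphabet \<Sigma> M \<times> UNIV)"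

text \<open>A configuration consists of the state, the tape contents and the head position.\<close>

type_synonym 'a config = "nat \<times> (nat \<Rightarrow> 'a tape_symbol) \<times> nat"

text \<open>By truncated subtraction, a left move in cell 0 leaves the head where it is.\<close>

fun move_head :: "direction \<Rightarrow> nat \<Rightarrow> nat" where
  "move_head MoveLeft h = h - 1"
| "move_head Stay h = h"
| "move_head MoveRight h = h + 1"

definition halted :: "'a tm \<Rightarrow> 'a config \<Rightarrow> bool" where
  "halted M c \<longleftrightarrow> fst c \<in> {tm_accept M, tm_reject M}"

definition tm_step :: "'a tm \<Rightarrow> 'a config \<Rightarrow> 'a config" where
  "tm_step M c =
     (if halted M c then c
      else case c of (q, tape, h) \<Rightarrow>
        (case tm_delta M q (tape h) of (q', x, d) \<Rightarrow> (q', tape(h := x), move_head d h)))"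

definition tape_of :: "'a list \<Rightarrow> nat \<Rightarrow> 'a tape_symbol" where
  "tape_of w = (\<lambda>i. if i < length w then Letter (w ! i) else Blank)"

definition tm_run :: "'a tm \<Rightarrow> 'a list \<Rightarrow> nat \<Rightarrow> 'a config" where
  "tm_run M w t = (tm_step M ^^ t) (tm_start M, tape_of w, 0)"

text \<open>
  On halting, the tape contains the value of the function and nothing else; the head may be
  anywhere, and either halting state may be used.
\<close>

definition computes_in_time ::
    "'a tm \<Rightarrow> 'a set \<Rightarrow> ('a list \<Rightarrow> 'a list) \<Rightarrow> (nat \<Rightarrow> nat) \<Rightarrow> bool" where
  "computes_in_time M \<Sigma> f T \<longleftrightarrow>
     (\<forall>w \<in> lists \<Sigma>. \<exists>t \<le> T (length w).
        halted M (tm_run M w t) \<and> fst (snd (tm_run M w t)) = tape_of (f w))"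

definition decides_in_time ::
    "'a tm \<Rightarrow> 'a set \<Rightarrow> 'a list set \<Rightarrow> (nat \<Rightarrow> nat) \<Rightarrow> bool" where
  "decides_in_time M \<Sigma> X T \<longleftrightarrow>
     (\<forall>w \<in> lists \<Sigma>. \<exists>t \<le> T (length w).
        halted M (tm_run M w t) \<and> (fst (tm_run M w t) = tm_accept M \<longleftrightarrow> w \<in> X))"

definition polynomial_time :: "(nat \<Rightarrow> nat) \<Rightarrow> bool" where
  "polynomial_time T \<longleftrightarrow>
     (\<exists>p :: real poly. (\<lambda>n. real (T n)) \<in> O(\<lambda>n. poly p (real n)))"

definition ptime_computable :: "'a set \<Rightarrow> ('a list \<Rightarrow> 'a list) \<Rightarrow> bool" where
  "ptime_computable \<Sigma> f \<longleftrightarrow>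
     f \<in> lists \<Sigma> \<rightarrow> lists \<Sigma> \<and>
     (\<exists>M T. turing_machine \<Sigma> M \<and> polynomial_time T \<and> computes_in_time M \<Sigma> f T)"

definition ptime_decidable :: "'a set \<Rightarrow> 'a list set \<Rightarrow> bool" where
  "ptime_decidable \<Sigma> X \<longleftrightarrow>
     (\<exists>M T. turing_machine \<Sigma> M \<and> polynomial_time T \<and> decides_in_time M \<Sigma> X T)"

section \<open>Words over generators\<close>

definition word_value :: "('g, 'm) monoid_scheme \<Rightarrow> 'g list \<Rightarrow> 'g" where
  "word_value G v = foldr (\<otimes>\<^bsub>G\<^esub>) v \<one>\<^bsub>G\<^esub>"

definition finite_semigroup_generators :: "('g, 'm) monoid_scheme \<Rightarrow> 'g set \<Rightarrow> bool" where
  "finite_semigroup_generators G S \<longleftrightarrow>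
     finite S \<and> S \<subseteq> carrier G \<and> (\<forall>g \<in> carrier G. \<exists>v \<in> lists S. v \<noteq> [] \<and> word_value G v = g)"

definition finite_generators :: "('g, 'm) monoid_scheme \<Rightarrow> 'g set \<Rightarrow> bool" where
  "finite_generators G A \<longleftrightarrow> finite A \<and> A \<subseteq> carrier G \<and> generate G A = carrier G"

definition sym_generators :: "('g, 'm) monoid_scheme \<Rightarrow> 'g set \<Rightarrow> 'g set" where
  "sym_generators G A = A \<union> (\<lambda>a. inv\<^bsub>G\<^esub> a) ` A"

definition word_length :: "('g, 'm) monoid_scheme \<Rightarrow> 'g set \<Rightarrow> 'g \<Rightarrow> nat" where
  "word_length G A g =
     (LEAST n. \<exists>v \<in> lists (sym_generators G A). length v = n \<and> word_value G v = g)"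

definition word_problem :: "('g, 'm) monoid_scheme \<Rightarrow> 'g set \<Rightarrow> 'g list set" where
  "word_problem G A = {v \<in> lists (sym_generators G A). word_value G v = \<one>\<^bsub>G\<^esub>}"

section \<open>Cayley polynomial-time computable representations\<close>

definition cayley_ptime_representation ::
    "('g, 'm) monoid_scheme \<Rightarrow> 'g set \<Rightarrow> 'a set \<Rightarrow> 'a list set \<Rightarrow> ('a list \<Rightarrow> 'g) \<Rightarrow> bool" where
  "cayley_ptime_representation G S \<Sigma> L \<psi> \<longleftrightarrow>
     finite \<Sigma> \<and> L \<subseteq> lists \<Sigma> \<and> bij_betw \<psi> L (carrier G) \<and>
     (\<forall>s \<in> S. \<exists>f. ptime_computable \<Sigma> f \<and> f ` L \<subseteq> L \<and>
        (\<forall>w \<in> L. \<psi> (f w) = \<psi> w \<otimes>\<^bsub>G\<^esub> s))"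

definition quasigeodesic_normal_form ::
    "('g, 'm) monoid_scheme \<Rightarrow> 'g set \<Rightarrow> 'a list set \<Rightarrow> ('a list \<Rightarrow> 'g) \<Rightarrow> bool" where
  "quasigeodesic_normal_form G A L \<psi> \<longleftrightarrow>
     (\<exists>C :: real. \<forall>w \<in> L. real (length w) \<le> C * (real (word_length G A (\<psi> w)) + 1))"

text \<open>
  The letters of the alphabet are taken to be natural numbers, which is no restriction since
  the alphabet is finite.
\<close>

definition cayley_ptime_quasigeodesic :: "('g, 'm) monoid_scheme \<Rightarrow> bool" where
  "cayley_ptime_quasigeodesic G \<longleftrightarrow>
     (\<exists>S A (\<Sigma> :: nat set) L \<psi>.
        finite_semigroup_generators G S \<and> finite_generators G A \<and>
        cayley_ptime_representation G S \<Sigma> L \<psi> \<and> quasigeodesic_normal_form G A L \<psi>)"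

end

theory Submission
  imports Defs "HOL-Library.Countable_Set"
begin

text \<open>
  Right multiplication by a semigroup generator acts on normal forms as a polynomial-time
  function. Starting from the normal form \<open>w0\<close> of the identity, a machine can therefore read
  the input word from left to right, spell each letter as a product of semigroup generators and
  apply the corresponding functions one after the other; the normal form at the end is \<open>w0\<close> iff
  the input represents the identity, because \<open>\<psi>\<close> is injective.

  Iterating a polynomial-time function linearly often does not in general take polynomial time,
  as the values may grow exponentially. Here the quasigeodesic property prevents this: the
  element reached after \<open>n\<close> letters has length \<open>O(n)\<close> in the generators, hence so has its normal
  form, and each single application costs a polynomial in \<open>n\<close>.

  The group enters only through this length bound. Its machine-theoretic counterpart is
  \<open>ptime_decidable_fold_return\<close>: iterates of polynomial-time functions along an input
  word can be compared with the initial value in polynomial time as long as their lengths stay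
  polynomially bounded. The machine for it keeps the input and the current value on two tracks
  of its tape. Since the value starts in cell 0, the machines of the single functions run on its
  track unchanged, including their left moves in cell 0. The one additional ability needed is to
  find the way back to cell 0 between two runs, and for this the cell carries a mark.
\<close>

section \<open>Polynomial bounds with natural coefficients\<close>

text \<open>
  Time bounds have to be monotone, since they are applied to words of which only a bound on the
  length is known, and closed under composition. Polynomials with natural coefficients have both
  properties, and every polynomial time bound lies below one of them.
\<close>

lemma poly_nat_mono:
  fixes p :: "nat poly"
  assumes "m \<le> n"
  shows "poly p m \<le> poly p n"
  by (induction p) (auto intro!: add_mono mult_mono assms)

lemma real_poly_le_nat_poly:
  fixes q :: "real poly"
  shows "\<exists>p :: nat poly. \<forall>n. \<bar>poly q (real n)\<bar> \<le> real (poly p n)"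
proof (induction q)
  case 0
  show ?case by (rule exI[of _ 0]) simp
next
  case (pCons a q)
  then obtain p :: "nat poly" where p: "\<bar>poly q (real n)\<bar> \<le> real (poly p n)" for n
    by blast
  have "\<bar>poly (pCons a q) (real n)\<bar> \<le> real (poly (pCons (nat \<lceil>\<bar>a\<bar>\<rceil>) p) n)" for n
  proof -
    have "\<bar>poly (pCons a q) (real n)\<bar> \<le> \<bar>a\<bar> + real n * \<bar>poly q (real n)\<bar>"
      using abs_triangle_ineq[of a "real n * poly q (real n)"] by (simp add: abs_mult)
    also have "\<dots> \<le> real (nat \<lceil>\<bar>a\<bar>\<rceil>) + real n * real (poly p n)"
      by (intro add_mono mult_left_mono p) linarith+
    finally show ?thesis by simp
  qed
  then show ?case by blast
qed

lemma polynomial_time_nat_poly: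
  assumes "polynomial_time T"
  shows "\<exists>p :: nat poly. \<forall>n. T n \<le> poly p n"
proof -
  obtain q :: "real poly" where "(\<lambda>n. real (T n)) \<in> O(\<lambda>n. poly q (real n))"
    using assms unfolding polynomial_time_def by blast
  then obtain c where "eventually (\<lambda>n. norm (real (T n)) \<le> c * norm (poly q (real n))) at_top"
    by (elim landau_o.bigE)
  then obtain N where N: "\<And>n. n \<ge> N \<Longrightarrow> real (T n) \<le> c * \<bar>poly q (real n)\<bar>"
    by (auto simp: eventually_at_top_linorder)
  obtain p :: "nat poly" where p: "\<And>n. \<bar>poly q (real n)\<bar> \<le> real (poly p n)"
    using real_poly_le_nat_poly by blast
  \<comment> \<open>The sum takes care of the finitely many arguments below the threshold of the \<open>O\<close>-bound.\<close>
  have "T n \<le> poly ([:nat \<lceil>\<bar>c\<bar>\<rceil>:] * p + [:\<Sum>i<N. T i:]) n" for n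
  proof (cases "n < N")
    case True
    then have "T n \<le> (\<Sum>i<N. T i)" by (intro member_le_sum) auto
    then show ?thesis by simp
  next
    case False
    then have "real (T n) \<le> c * \<bar>poly q (real n)\<bar>" using N by simp
    also have "\<dots> \<le> real (nat \<lceil>\<bar>c\<bar>\<rceil>) * real (poly p n)"
      by (rule mult_mono) (use p in \<open>auto intro: order_trans\<close>, linarith)
    finally have "T n \<le> nat \<lceil>\<bar>c\<bar>\<rceil> * poly p n"
      by (metis of_nat_le_iff of_nat_mult)
    then show ?thesis by simp
  qed
  then show ?thesis by blast
qed

lemma polynomial_time_poly: "polynomial_time (poly (p :: nat poly))"
proof -
  have "real (poly p n) = poly (map_poly real p) (real n)" for n
    by (induction p) (auto simp: map_poly_pCons)
  then show ?thesis
    unfolding polynomial_time_def by (intro exI[of _ "map_poly real p"]) simp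
qed

section \<open>Two-track machines with a recognizable first cell\<close>

text \<open>
  A program for two tracks with a common head, whose transitions may depend on whether the head
  is in cell 0. Programs are easier to reason about than Turing machines because the tracks are
  separate functions and the mark on cell 0 is not part of their contents. Every such program is
  realized by a Turing machine: an auxiliary symbol encodes the two symbols in a cell together
  with the mark, and an additional first step puts the mark into cell 0.
\<close>

locale two_track =
  fixes B :: "'a set" and Q :: "'q set"
    and X :: "'a tape_symbol set" and Y :: "'b tape_symbol set"
    and start accept reject :: 'q
    and delta :: "'q \<Rightarrow> bool \<Rightarrow> 'a tape_symbol \<Rightarrow> 'b tape_symbol
                    \<Rightarrow> 'q \<times> 'a tape_symbol \<times> 'b tape_symbol \<times> direction"
  assumes finite: "finite B" "finite Q" "finite X" "finite Y"
    and states: "start \<in> Q" "accept \<in> Q" "reject \<in> Q" "accept \<noteq> reject"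
    and symbols: "Blank \<in> X" "Letter ` B \<subseteq> X" "Blank \<in> Y"
    and closed: "\<lbrakk>q \<in> Q; x \<in> X; y \<in> Y\<rbrakk> \<Longrightarrow> delta q m x y \<in> Q \<times> X \<times> Y \<times> UNIV"
begin

definition step where
  "step c = (case c of (q, x, y, h) \<Rightarrow>
     if q \<in> {accept, reject} then c
     else case delta q (h = 0) (x h) (y h) of (q', a, b, d) \<Rightarrow>
       (q', x(h := a), y(h := b), move_head d h))"

definition reaches where
  "reaches t c c' \<longleftrightarrow> (\<exists>k \<le> t. (step ^^ k) c = c')"

lemma reaches_refl: "reaches t c c"
  unfolding reaches_def by (rule exI[of _ 0]) simp

lemma reaches_mono: "reaches t c c' \<Longrightarrow> t \<le> t' \<Longrightarrow> reaches t' c c'"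
  unfolding reaches_def using order_trans by blast

lemma reaches_trans:
  assumes "reaches t c c'" "reaches t' c' c''"
  shows "reaches (t + t') c c''"
proof -
  obtain k k' where "k \<le> t" "(step ^^ k) c = c'" "k' \<le> t'" "(step ^^ k') c' = c''"
    using assms unfolding reaches_def by blast
  then show ?thesis
    unfolding reaches_def by (intro exI[of _ "k' + k"]) (simp add: funpow_add)
qed

lemma reaches_step: "step c = c' \<Longrightarrow> reaches 1 c c'"
  unfolding reaches_def by (rule exI[of _ 1]) simp

definition cells where "cells = X \<times> (UNIV :: bool set) \<times> Y"

definition codes where "codes = insert None (Some ` Q)"

text \<open>
  Reading unencoded symbols as cells with an empty second track makes it unnecessary to
  translate the input before the program starts.
\<close>

definition view :: "'a tape_symbol \<Rightarrow> 'a tape_symbol \<times> bool \<times> 'b tape_symbol" where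
  "view s = (case s of Aux n \<Rightarrow> from_nat_into cells n | _ \<Rightarrow> (s, False, Blank))"

definition cell where "cell c = Aux (to_nat_on cells c)"

definition code where "code = to_nat_on codes"

text \<open>The state \<open>None\<close> is the one in which the mark is written.\<close>

definition machine :: "'a tm" where
  "machine = \<lparr>tm_states = code ` codes, tm_aux = to_nat_on cells ` cells,
     tm_start = code None, tm_accept = code (Some accept), tm_reject = code (Some reject),
     tm_delta = (\<lambda>n s. case view s of (x, m, y) \<Rightarrow>
       (case from_nat_into codes n of
          None \<Rightarrow> (code (Some start), cell (x, True, y), Stay)
        | Some q \<Rightarrow> (case delta q m x y of (q', x', y', d) \<Rightarrow>
            (code (Some q'), cell (x', m, y'), d))))\<rparr>"

lemma finite_cells: "finite cells" and finite_codes: "finite codes"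
  unfolding cells_def codes_def using finite by auto

lemma view_cell: "c \<in> cells \<Longrightarrow> view (cell c) = c"
  using finite_cells by (simp add: view_def cell_def countable_finite)

lemma decode: "c \<in> codes \<Longrightarrow> from_nat_into codes (code c) = c"
  using finite_codes by (simp add: code_def countable_finite)

lemma code_eq_iff: "c \<in> codes \<Longrightarrow> c' \<in> codes \<Longrightarrow> code c = code c' \<longleftrightarrow> c = c'"
  by (metis decode)

lemma view_in_cells: "s \<in> tape_alphabet B machine \<Longrightarrow> view s \<in> cells"
  using symbols finite_cells
  by (auto simp: tape_alphabet_def machine_def view_def countable_finite)
    (auto simp: cells_def)

lemma turing_machine_machine: "turing_machine B machine"
proof -
  have "tm_delta machine (code c) s \<in> tm_states machine \<times> tape_alphabet B machine \<times> UNIV"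
    if c: "c \<in> codes" and s: "s \<in> tape_alphabet B machine" for c s
  proof -
    obtain x m y where v: "view s = (x, m, y)" by (metis prod_cases3)
    then have xy: "x \<in> X" "y \<in> Y" using view_in_cells[OF s] by (auto simp: cells_def)
    show ?thesis
    proof (cases c)
      case None
      then show ?thesis
        using v xy states c decode[OF c]
        by (auto simp: machine_def tape_alphabet_def cell_def cells_def codes_def)
    next
      case (Some q)
      then have "q \<in> Q" using c by (auto simp: codes_def)
      obtain q' x' y' d where e: "delta q m x y = (q', x', y', d)" by (metis prod_cases4)
      then show ?thesis
        using v xy c decode[OF c] Some closed[OF \<open>q \<in> Q\<close> xy, of m]
        by (auto simp: machine_def tape_alphabet_def cell_def cells_def codes_def)
    qed
  qed
  then show ?thesis
    using finite finite_cells finite_codes states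
    unfolding turing_machine_def by (auto simp: machine_def code_eq_iff codes_def)
qed

fun represents where
  "represents (q, x, y, h) (n, tape, h') \<longleftrightarrow>
     q \<in> Q \<and> n = code (Some q) \<and> h' = h \<and> range x \<subseteq> X \<and> range y \<subseteq> Y \<and>
     (\<forall>i. view (tape i) = (x i, i = 0, y i))"

lemma halted_iff:
  assumes "represents c c'"
  shows "halted machine c' \<longleftrightarrow> fst c \<in> {accept, reject}"
    and "fst c' = tm_accept machine \<longleftrightarrow> fst c = accept"
proof -
  obtain q x y h where c: "c = (q, x, y, h)" by (metis prod_cases4)
  obtain n tape h' where c': "c' = (n, tape, h')" by (metis prod_cases3)
  show "halted machine c' \<longleftrightarrow> fst c \<in> {accept, reject}"
    and "fst c' = tm_accept machine \<longleftrightarrow> fst c = accept"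
    using assms states unfolding c c'
    by (auto simp: halted_def machine_def code_eq_iff codes_def)
qed

lemma represents_step:
  assumes "represents c c'"
  shows "represents (step c) (tm_step machine c')"
proof -
  obtain q x y h where c: "c = (q, x, y, h)" by (metis prod_cases4)
  obtain n tape h' where c': "c' = (n, tape, h')" by (metis prod_cases3)
  show ?thesis
  proof (cases "q \<in> {accept, reject}")
    case True
    then show ?thesis
      using assms halted_iff[OF assms] by (simp add: c c' step_def tm_step_def)
  next
    case False
    have r: "q \<in> Q" "n = code (Some q)" "h' = h" "range x \<subseteq> X" "range y \<subseteq> Y"
      "view (tape i) = (x i, i = 0, y i)" for i
      using assms by (auto simp: c c')
    obtain q' a b d where e: "delta q (h = 0) (x h) (y h) = (q', a, b, d)"
      by (metis prod_cases4)
    have cl: "q' \<in> Q" "a \<in> X" "b \<in> Y"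
      using closed[of q "x h" "y h" "h = 0"] r(1,4,5) e by auto
    have "from_nat_into codes n = Some q" using r(1,2) decode[of "Some q"] by (simp add: codes_def)
    then have "tm_delta machine n (tape h) = (code (Some q'), cell (a, h = 0, b), d)"
      by (simp add: machine_def r(6) e)
    then have "tm_step machine c' =
        (code (Some q'), tape(h := cell (a, h = 0, b)), move_head d h)"
      using False halted_iff(1)[OF assms] r(3) by (simp add: c c' tm_step_def)
    moreover have "step c = (q', x(h := a), y(h := b), move_head d h)"
      using False e by (simp add: c step_def)
    ultimately show ?thesis
      using r cl by (auto simp: view_cell cells_def)
  qed
qed

text \<open>
  The first step of the machine writes the mark; from then on it runs in lockstep with the
  program.
\<close>

lemma represents_start:
  assumes "v \<in> lists B"
  shows "represents (start, tape_of v, \<lambda>_. Blank, 0) (tm_run machine v 1)"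
proof -
  have X: "tape_of v i \<in> X" for i
    using assms symbols by (auto simp: tape_of_def in_lists_conv_set)
  have view: "view (tape_of v i) = (tape_of v i, False, Blank)" for i
    by (simp add: view_def tape_of_def)
  have "from_nat_into codes (code None) = None" using decode[of None] by (simp add: codes_def)
  moreover have "\<not> halted machine (tm_start machine, tape_of v, 0)"
    using states by (simp add: halted_def machine_def code_eq_iff codes_def)
  ultimately have "tm_run machine v 1 =
      (code (Some start), (tape_of v)(0 := cell (tape_of v 0, True, Blank)), 0)"
    by (simp add: tm_run_def tm_step_def machine_def view)
  then show ?thesis
    using X states(1) symbols by (auto simp: view_cell cells_def view)
qed

lemma decides_in_time_machine:
  assumes "\<And>v. v \<in> lists B \<Longrightarrow> \<exists>c. reaches (T (length v)) (start, tape_of v, \<lambda>_. Blank, 0) c \<and>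
      fst c = (if v \<in> W then accept else reject)"
  shows "decides_in_time machine B W (\<lambda>n. T n + 1)"
  unfolding decides_in_time_def
proof
  fix v assume v: "v \<in> lists B"
  let ?c = "(start, tape_of v, \<lambda>_. Blank, 0)"
  obtain k where k: "k \<le> T (length v)"
      "fst ((step ^^ k) ?c) = (if v \<in> W then accept else reject)"
    using assms[OF v] unfolding reaches_def by blast
  have "represents ((step ^^ k) ?c) (tm_run machine v (k + 1))" for k
  proof (induction k)
    case 0
    show ?case using represents_start[OF v] by simp
  next
    case (Suc k)
    then show ?case using represents_step[OF Suc] by (simp add: tm_run_def)
  qed
  from halted_iff[OF this[of k]] k states
  show "\<exists>t \<le> T (length v) + 1. halted machine (tm_run machine v t) \<and>
      (fst (tm_run machine v t) = tm_accept machine \<longleftrightarrow> v \<in> W)"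
    by (intro exI[of _ "k + 1"]) (auto split: if_splits)
qed

end

section \<open>Iterating polynomial-time functions along an input word\<close>

text \<open>
  The program for \<open>ptime_decidable_fold_return\<close>. \<open>Write ls\<close> and \<open>Check ls\<close> move along the value
  track, with \<open>ls\<close> the part of \<open>w0\<close> that is still to be written or compared. \<open>Back q\<close> returns to
  cell 0 and then enters \<open>q\<close>. \<open>Fetch\<close> looks for the first unread input letter. \<open>Sim s n us\<close>
  simulates the machine for \<open>s\<close>, currently in its state \<open>n\<close>, and remembers that the functions
  \<open>us\<close> are to be applied afterwards.
\<close>

datatype ('s, 'b) state =
    Write "'b list"
  | Back "('s, 'b) state"
  | Fetch
  | Sim 's nat "'s list"
  | Check "'b list"
  | Accept
  | Reject

locale iteration =
  fixes B :: "'a set" and S :: "'s set" and \<Sigma> :: "'b set"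
    and u :: "'a \<Rightarrow> 's list" and M :: "'s \<Rightarrow> 'b tm" and f :: "'s \<Rightarrow> 'b list \<Rightarrow> 'b list"
    and w0 :: "'b list" and p r :: "nat poly" and U :: nat
  assumes fin: "finite B" "finite S" "finite \<Sigma>"
    and u: "a \<in> B \<Longrightarrow> u a \<in> lists S" "a \<in> B \<Longrightarrow> length (u a) \<le> U"
    and w0: "w0 \<in> lists \<Sigma>"
    and M: "s \<in> S \<Longrightarrow> turing_machine \<Sigma> (M s)"
    and f: "s \<in> S \<Longrightarrow> w \<in> lists \<Sigma> \<Longrightarrow> f s w \<in> lists \<Sigma>"
    and run: "s \<in> S \<Longrightarrow> computes_in_time (M s) \<Sigma> (f s) (poly p)"
    and len: "z \<in> lists S \<Longrightarrow> length (fold f z w0) \<le> poly r (length z)"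
begin

fun pending where
  "pending [] = Fetch"
| "pending (s # us) = Sim s (tm_start (M s)) us"

text \<open>
  On the input track \<open>Aux 0\<close> stands for a letter that has been read; a blank shows that there is
  no further letter. The test for the tape alphabet of the simulated machine is always
  passed in an actual run; it keeps the transition function within finitely many states and
  symbols, as the different machines share one track but not their alphabets.
\<close>

fun delta where
  "delta (Write []) m x y = (Back Fetch, x, y, Stay)"
| "delta (Write (l # ls)) m x y = (Write ls, x, Letter l, MoveRight)"
| "delta (Back q) m x y = (if m then (q, x, y, Stay) else (Back q, x, y, MoveLeft))"
| "delta Fetch m x y = (case x of
      Letter a \<Rightarrow> (Back (pending (u a)), Aux 0, y, Stay)
    | Aux n \<Rightarrow> (Fetch, x, y, MoveRight)
    | Blank \<Rightarrow> (Back (Check w0), x, y, Stay))"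
| "delta (Sim s q us) m x y =
    (if q \<in> {tm_accept (M s), tm_reject (M s)} then (Back (pending us), x, y, Stay)
     else if y \<in> tape_alphabet \<Sigma> (M s) then
       (case tm_delta (M s) q y of (q', y', d) \<Rightarrow> (Sim s q' us, x, y', d))
     else (Reject, x, y, Stay))"
| "delta (Check []) m x y = (if y = Blank then Accept else Reject, x, y, Stay)"
| "delta (Check (l # ls)) m x y =
    (if y = Letter l then (Check ls, x, y, MoveRight) else (Reject, x, y, Stay))"
| "delta q m x y = (q, x, y, Stay)"

text \<open>
  The states to which \<open>Back\<close> may hand over. The datatype permits nested returns, but the program uses
  just one level, so that finitely many states suffice.
\<close>

definition targets :: "('s, 'b) state set" where
  "targets = {Fetch, Accept, Reject}
     \<union> Write ` {ls. set ls \<subseteq> \<Sigma> \<and> length ls \<le> length w0}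
     \<union> Check ` {ls. set ls \<subseteq> \<Sigma> \<and> length ls \<le> length w0}
     \<union> (\<Union>s\<in>S. \<Union>q\<in>tm_states (M s). Sim s q ` {us. set us \<subseteq> S \<and> length us \<le> U})"

definition Q where "Q = targets \<union> Back ` targets"

definition X :: "'a tape_symbol set" where "X = {Blank, Aux 0} \<union> Letter ` B"

definition Y :: "'b tape_symbol set" where
  "Y = {Blank} \<union> Letter ` \<Sigma> \<union> (\<Union>s\<in>S. tape_alphabet \<Sigma> (M s))"

lemma finite_Q: "finite Q"
  unfolding Q_def targets_def
  using fin M by (auto intro!: finite_lists_length_le simp: turing_machine_def)

lemma finite_Y: "finite Y"
  unfolding Y_def tape_alphabet_def using fin M by (auto simp: turing_machine_def)

lemma pending_in_targets: "set us \<subseteq> S \<Longrightarrow> length us \<le> U \<Longrightarrow> pending us \<in> targets"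
proof (cases us)
  case (Cons s us')
  assume "set us \<subseteq> S" "length us \<le> U"
  then have "s \<in> S" "us' \<in> {us. set us \<subseteq> S \<and> length us \<le> U}" using Cons by auto
  moreover have "tm_start (M s) \<in> tm_states (M s)"
    using M[OF \<open>s \<in> S\<close>] by (simp add: turing_machine_def)
  ultimately show ?thesis unfolding Cons pending.simps targets_def by blast
qed (simp add: targets_def)

lemma delta_closed:
  assumes "q \<in> Q" "x \<in> X" "y \<in> Y"
  shows "delta q m x y \<in> Q \<times> X \<times> Y \<times> UNIV"
proof (cases "q \<in> targets")
  case False
  then show ?thesis using assms by (auto simp: Q_def)
next
  case True
  then consider "q = Fetch" | "q \<in> {Accept, Reject}"
    | ls where "q = Write ls" "set ls \<subseteq> \<Sigma>" "length ls \<le> length w0"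
    | ls where "q = Check ls" "set ls \<subseteq> \<Sigma>" "length ls \<le> length w0"
    | s n us where "q = Sim s n us" "s \<in> S" "n \<in> tm_states (M s)" "set us \<subseteq> S" "length us \<le> U"
    unfolding targets_def by blast
  then show ?thesis
  proof cases
    case 1
    have "Check w0 \<in> targets" using w0 by (auto simp: targets_def in_lists_conv_set)
    moreover have "pending (u a) \<in> targets" if "a \<in> B" for a
      using pending_in_targets u[OF that] by (auto simp: in_lists_conv_set)
    ultimately show ?thesis
      using 1 assms by (auto simp: Q_def X_def)
  next
    case 2
    then show ?thesis using assms by auto
  next
    case (3 ls)
    then show ?thesis
      using assms by (cases ls) (auto simp: Q_def targets_def Y_def)
  next
    case (4 ls)
    then show ?thesis
      using assms by (cases ls) (auto simp: Q_def targets_def)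
  next
    case (5 s n us)
    have "tm_delta (M s) n y \<in> tm_states (M s) \<times> tape_alphabet \<Sigma> (M s) \<times> UNIV"
      if "n \<notin> {tm_accept (M s), tm_reject (M s)}" "y \<in> tape_alphabet \<Sigma> (M s)"
      using M[OF \<open>s \<in> S\<close>] that 5 by (auto simp: turing_machine_def)
    then have "\<exists>n' y' d. tm_delta (M s) n y = (n', y', d) \<and> n' \<in> tm_states (M s) \<and>
        y' \<in> tape_alphabet \<Sigma> (M s)"
      if "n \<notin> {tm_accept (M s), tm_reject (M s)}" "y \<in> tape_alphabet \<Sigma> (M s)"
      using that by (cases "tm_delta (M s) n y") auto
    moreover have "Sim s n' us \<in> Q" if "n' \<in> tm_states (M s)" for n'
      using 5 that unfolding Q_def targets_def by blast
    moreover have "Back (pending us) \<in> Q" using pending_in_targets[of us] 5 by (simp add: Q_def)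
    moreover have "Reject \<in> Q" by (simp add: Q_def targets_def)
    moreover have "tape_alphabet \<Sigma> (M s) \<subseteq> Y" using 5 by (auto simp: Y_def)
    ultimately show ?thesis
      using assms(2,3) unfolding \<open>q = Sim s n us\<close> by fastforce
  qed
qed

sublocale two_track B Q X Y "Write w0" Accept Reject delta
proof
  show "finite B" "finite Q" "finite X" "finite Y"
    using fin finite_Q finite_Y by (auto simp: X_def)
  show "Write w0 \<in> Q" using w0 by (auto simp: Q_def targets_def in_lists_conv_set)
qed (use delta_closed in \<open>auto simp: Q_def targets_def X_def Y_def\<close>)

lemma reaches_Back:
  assumes "h \<le> t"
  shows "reaches (t + 1) (Back q, x, y, h) (q, x, y, 0)"
  using assms
proof (induction h arbitrary: t)
  case 0
  have "step (Back q, x, y, 0) = (q, x, y, 0)" by (simp add: step_def)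
  from reaches_step[OF this] show ?case by (rule reaches_mono) simp
next
  case (Suc h)
  then obtain t' where t: "t = Suc t'" "h \<le> t'" by (cases t) auto
  have "step (Back q, x, y, Suc h) = (Back q, x, y, h)" by (simp add: step_def)
  from reaches_trans[OF reaches_step[OF this] Suc.IH[OF t(2)]] show ?case
    by (rule reaches_mono) (simp add: t)
qed

lemma tape_of_snoc: "(tape_of w)(length w := Letter l) = tape_of (w @ [l])"
  by (auto simp: tape_of_def fun_eq_iff nth_append)

lemma reaches_Write:
  "reaches (length ls) (Write ls, x, tape_of w, length w)
     (Write [], x, tape_of (w @ ls), length (w @ ls))"
proof (induction ls arbitrary: w)
  case Nil
  show ?case by (simp add: reaches_refl)
next
  case (Cons l ls)
  have "step (Write (l # ls), x, tape_of w, length w)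
      = (Write ls, x, tape_of (w @ [l]), length (w @ [l]))"
    by (simp add: step_def tape_of_snoc)
  from reaches_trans[OF reaches_step[OF this] Cons.IH] show ?case by simp
qed

lemma reaches_init:
  "reaches (2 * length w0 + 2) (Write w0, x, \<lambda>_. Blank, 0) (Fetch, x, tape_of w0, 0)"
proof -
  have blank: "(\<lambda>_. Blank) = tape_of []" by (simp add: tape_of_def)
  have "step (Write [], x, tape_of w0, length w0) = (Back Fetch, x, tape_of w0, length w0)"
    by (simp add: step_def)
  note reaches_step[OF this]
  from reaches_trans[OF reaches_trans[OF _ this] reaches_Back[OF order_refl]]
    reaches_Write[of w0 x "[]"]
  have "reaches (length w0 + 1 + (length w0 + 1)) (Write w0, x, \<lambda>_. Blank, 0)
      (Fetch, x, tape_of w0, 0)"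
    by (simp add: blank)
  then show ?thesis by (rule reaches_mono) simp
qed

lemma reaches_Check:
  "\<exists>h. reaches (length ls + 1) (Check ls, x, tape_of (w @ ws), length w)
     (if ws = ls then Accept else Reject, x, tape_of (w @ ws), h)"
proof (induction ls arbitrary: w ws)
  case Nil
  have "step (Check [], x, tape_of (w @ ws), length w)
      = (if ws = [] then Accept else Reject, x, tape_of (w @ ws), length w)"
    by (simp add: step_def tape_of_def)
  from reaches_step[OF this] show ?case by auto
next
  case (Cons l ls)
  show ?case
  proof (cases "ws \<noteq> [] \<and> hd ws = l")
    case True
    then obtain ws' where ws: "ws = l # ws'" by (cases ws) auto
    have "step (Check (l # ls), x, tape_of (w @ ws), length w)
        = (Check ls, x, tape_of ((w @ [l]) @ ws'), length (w @ [l]))"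
      by (auto simp: step_def tape_of_def ws fun_eq_iff nth_append)
    note reaches_trans[OF reaches_step[OF this]]
    with Cons.IH[of "w @ [l]" ws'] show ?thesis by (fastforce simp: ws)
  next
    case False
    have "step (Check (l # ls), x, tape_of (w @ ws), length w)
        = (Reject, x, tape_of (w @ ws), length w)"
      using False by (cases ws) (auto simp: step_def tape_of_def)
    from reaches_step[OF this] have "reaches (length (l # ls) + 1)
        (Check (l # ls), x, tape_of (w @ ws), length w) (Reject, x, tape_of (w @ ws), length w)"
      by (rule reaches_mono) simp
    moreover have "ws \<noteq> l # ls" using False by auto
    ultimately show ?thesis by auto
  qed
qed

text \<open>
  One step of the program is one step of the simulated machine, until the latter halts; the
  simulated configuration then stays put, which is why the bound \<open>t\<close> covers both cases. The bound
  on the head position is what limits the time for the return to cell 0.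
\<close>

lemma reaches_Sim:
  assumes s: "s \<in> S" and w: "w \<in> lists \<Sigma>" and c: "tm_run (M s) w t = (q, y, h)"
  shows "reaches t (Sim s (tm_start (M s)) us, x, tape_of w, 0) (Sim s q us, x, y, h)
    \<and> q \<in> tm_states (M s) \<and> range y \<subseteq> tape_alphabet \<Sigma> (M s) \<and> h \<le> t"
  using c
proof (induction t arbitrary: q y h)
  case 0
  then show ?case
    using M[OF s] w
    by (auto simp: tm_run_def reaches_refl turing_machine_def tape_alphabet_def tape_of_def
        in_lists_conv_set)
next
  case (Suc t)
  obtain q1 y1 h1 where c1: "tm_run (M s) w t = (q1, y1, h1)" by (metis prod_cases3)
  note IH = Suc.IH[OF c1]
  have st: "tm_step (M s) (q1, y1, h1) = (q, y, h)"
    using Suc.prems c1 by (simp add: tm_run_def)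
  show ?case
  proof (cases "q1 \<in> {tm_accept (M s), tm_reject (M s)}")
    case True
    then show ?thesis using st IH reaches_mono[of t _ _ "Suc t"]
      by (auto simp: tm_step_def halted_def)
  next
    case False
    obtain q2 b d where e: "tm_delta (M s) q1 (y1 h1) = (q2, b, d)" by (metis prod_cases3)
    have y1: "y1 h1 \<in> tape_alphabet \<Sigma> (M s)" using IH by auto
    have cl: "q2 \<in> tm_states (M s)" "b \<in> tape_alphabet \<Sigma> (M s)"
      using M[OF s] False IH y1 e unfolding turing_machine_def by force+
    have new: "q = q2" "y = y1(h1 := b)" "h = move_head d h1"
      using st False e by (auto simp: tm_step_def halted_def)
    have "step (Sim s q1 us, x, y1, h1) = (Sim s q us, x, y, h)"
      using False e y1 by (simp add: step_def new)
    from reaches_trans[OF conjunct1[OF IH] reaches_step[OF this]]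
    have "reaches (Suc t) (Sim s (tm_start (M s)) us, x, tape_of w, 0) (Sim s q us, x, y, h)"
      by simp
    moreover have "h \<le> Suc t" using IH by (cases d) (auto simp: new)
    moreover have "range y \<subseteq> tape_alphabet \<Sigma> (M s)" using IH cl(2) by (auto simp: new)
    ultimately show ?thesis using cl(1) by (simp add: new(1))
  qed
qed

lemma reaches_generator:
  assumes s: "s \<in> S" and w: "w \<in> lists \<Sigma>" and D: "poly p (length w) \<le> D"
  shows "reaches (2 * D + 2) (pending (s # us), x, tape_of w, 0) (pending us, x, tape_of (f s w), 0)"
proof -
  obtain t where t: "t \<le> poly p (length w)" "halted (M s) (tm_run (M s) w t)"
      "fst (snd (tm_run (M s) w t)) = tape_of (f s w)"
    using run[OF s] w unfolding computes_in_time_def by blast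
  obtain q h where c: "tm_run (M s) w t = (q, tape_of (f s w), h)"
    using t(3) by (metis prod.collapse)
  have q: "q \<in> {tm_accept (M s), tm_reject (M s)}" using t(2) by (simp add: halted_def c)
  note sim = reaches_Sim[OF s w c]
  have "step (Sim s q us, x, tape_of (f s w), h) = (Back (pending us), x, tape_of (f s w), h)"
    using q by (simp add: step_def)
  note reaches_trans[OF reaches_trans[OF conjunct1[OF sim] reaches_step[OF this]]
      reaches_Back[of h t]]
  then have "reaches (t + 1 + (t + 1)) (pending (s # us), x, tape_of w, 0)
      (pending us, x, tape_of (f s w), 0)"
    using sim by simp
  then show ?thesis by (rule reaches_mono) (use t(1) D in simp)
qed

lemma fold_in_lists: "z \<in> lists S \<Longrightarrow> w \<in> lists \<Sigma> \<Longrightarrow> fold f z w \<in> lists \<Sigma>"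
proof (induction z arbitrary: w)
  case (Cons s z)
  then have "f s w \<in> lists \<Sigma>" using f by simp
  with Cons.IH Cons.prems(1) show ?case by simp
qed simp

text \<open>
  The value is written as an iterate at a word \<open>z\<close>, not as an arbitrary word, since only
  iterates obey the length bound \<open>r\<close>. All of \<open>z @ us\<close> is bounded by \<open>N\<close> so that the same time
  bound serves for each function in \<open>us\<close>.
\<close>

lemma reaches_generators:
  assumes "z @ us \<in> lists S" "length (z @ us) \<le> N"
  shows "reaches (length us * (2 * poly p (poly r N) + 2))
     (pending us, x, tape_of (fold f z w0), 0) (Fetch, x, tape_of (fold f (z @ us) w0), 0)"
  using assms
proof (induction us arbitrary: z)
  case Nil
  show ?case by (simp add: reaches_refl)
next
  case (Cons s us)
  have z: "z \<in> lists S" "s \<in> S" using Cons.prems by auto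
  have "length (fold f z w0) \<le> poly r N"
    using len[OF z(1)] poly_nat_mono[of "length z" N r] Cons.prems by simp
  then have "poly p (length (fold f z w0)) \<le> poly p (poly r N)" by (rule poly_nat_mono)
  from reaches_trans[OF reaches_generator[OF z(2) fold_in_lists[OF z(1) w0] this]
      Cons.IH[of "z @ [s]", simplified]] Cons.prems
  show ?case by (simp add: algebra_simps)
qed

text \<open>The input track after the first \<open>j\<close> letters have been read.\<close>

definition read_mark where
  "read_mark j v = (\<lambda>i. if i < j then Aux 0 else tape_of v i)"

lemma reaches_Fetch:
  "h \<le> j \<Longrightarrow> reaches (j - h) (Fetch, read_mark j v, y, h) (Fetch, read_mark j v, y, j)"
proof (induction "j - h" arbitrary: h)
  case 0
  then show ?case by (simp add: reaches_refl)
next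
  case (Suc n)
  have "h < j" using Suc.hyps(2) by simp
  then have "step (Fetch, read_mark j v, y, h) = (Fetch, read_mark j v, y, Suc h)"
    by (simp add: step_def read_mark_def fun_eq_iff)
  from reaches_trans[OF reaches_step[OF this] Suc.hyps(1)[of "Suc h"]] Suc.hyps(2) \<open>h < j\<close>
  show ?case by (simp add: Suc_diff_Suc)
qed

text \<open>
  The time for one letter: finding it and returning takes at most \<open>2 * n + 2\<close> steps. The letter
  stands for at most \<open>U\<close> functions, and each of them is applied to a word of length at most \<open>r (n * U)\<close> and
  followed by another return.
\<close>

definition letter_time where
  "letter_time n = 2 * n + 2 + U * (2 * poly p (poly r (n * U)) + 2)"

lemma length_concat_le:
  "v \<in> lists B \<Longrightarrow> length (concat (map u v)) \<le> length v * U"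
  by (induction v) (auto intro: add_mono u)

lemma concat_in_lists: "v \<in> lists B \<Longrightarrow> concat (map u v) \<in> lists S"
  by (induction v) (auto simp: u)

lemma reaches_letters:
  assumes v: "v \<in> lists B" and "j \<le> length v"
  shows "reaches (j * letter_time (length v)) (Fetch, tape_of v, tape_of w0, 0)
     (Fetch, read_mark j v, tape_of (fold f (concat (map u (take j v))) w0), 0)"
  using assms(2)
proof (induction j)
  case 0
  show ?case by (simp add: reaches_refl read_mark_def)
next
  case (Suc j)
  let ?z = "concat (map u (take j v))" and ?a = "v ! j"
  let ?y = "tape_of (fold f ?z w0)"
  have j: "j < length v" using Suc by simp
  have a: "?a \<in> B" using v j by (auto simp: in_lists_conv_set)
  have take: "concat (map u (take (Suc j) v)) = ?z @ u ?a"
    using j by (simp add: take_Suc_conv_app_nth)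
  have le: "length (?z @ u ?a) \<le> length v * U"
  proof -
    have "take (Suc j) v \<in> lists B" using v by (auto simp: in_lists_conv_set dest: in_set_takeD)
    from length_concat_le[OF this] have "length (?z @ u ?a) \<le> Suc j * U"
      using take j by simp
    also have "\<dots> \<le> length v * U" using j by (intro mult_right_mono) auto
    finally show ?thesis .
  qed
  have S: "?z @ u ?a \<in> lists S"
    using concat_in_lists[of "take (Suc j) v"] v unfolding take
    by (auto simp: in_lists_conv_set dest: in_set_takeD)
  have "step (Fetch, read_mark j v, ?y, j) = (Back (pending (u ?a)), read_mark (Suc j) v, ?y, j)"
    using j by (auto simp: step_def read_mark_def tape_of_def fun_eq_iff)
  note step = reaches_step[OF this]
  have "reaches (j + 1 + (j + 1) + length (u ?a) * (2 * poly p (poly r (length v * U)) + 2))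
     (Fetch, read_mark j v, ?y, 0)
     (Fetch, read_mark (Suc j) v, tape_of (fold f (?z @ u ?a) w0), 0)"
    using reaches_trans[OF reaches_trans[OF reaches_trans[OF reaches_Fetch[of 0 j v ?y] step]
        reaches_Back[OF order_refl]] reaches_generators[OF S le]]
    by simp
  then have "reaches (letter_time (length v)) (Fetch, read_mark j v, ?y, 0)
     (Fetch, read_mark (Suc j) v, tape_of (fold f (?z @ u ?a) w0), 0)"
  proof (rule reaches_mono)
    have "length (u ?a) * (2 * poly p (poly r (length v * U)) + 2)
        \<le> U * (2 * poly p (poly r (length v * U)) + 2)"
      using u(2)[OF a] by (rule mult_right_mono) simp
    then show "j + 1 + (j + 1) + length (u ?a) * (2 * poly p (poly r (length v * U)) + 2)
        \<le> letter_time (length v)"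
      using j unfolding letter_time_def by linarith
  qed
  from reaches_trans[OF Suc.IH this] j show ?case
    unfolding take by (simp add: add.commute)
qed

definition total_time where
  "total_time n = (2 * length w0 + 2) + n * letter_time n + (2 * n + 2) + (length w0 + 1)"

lemma reaches_verdict:
  assumes v: "v \<in> lists B"
  shows "\<exists>c. reaches (total_time (length v)) (Write w0, tape_of v, \<lambda>_. Blank, 0) c \<and>
    fst c = (if fold f (concat (map u v)) w0 = w0 then Accept else Reject)"
proof -
  let ?n = "length v" and ?w = "fold f (concat (map u v)) w0"
  let ?x = "read_mark ?n v"
  have "step (Fetch, ?x, tape_of ?w, ?n) = (Back (Check w0), ?x, tape_of ?w, ?n)"
    by (auto simp: step_def read_mark_def tape_of_def fun_eq_iff)
  note step = reaches_step[OF this]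
  have letters: "reaches (2 * length w0 + 2 + ?n * letter_time ?n)
      (Write w0, tape_of v, \<lambda>_. Blank, 0) (Fetch, ?x, tape_of ?w, 0)"
    using reaches_trans[OF reaches_init reaches_letters[OF v order_refl]] by simp
  have home: "reaches (2 * ?n + 2) (Fetch, ?x, tape_of ?w, 0) (Check w0, ?x, tape_of ?w, 0)"
    using reaches_trans[OF reaches_trans[OF reaches_Fetch[of 0 ?n v "tape_of ?w"] step]
        reaches_Back[OF order_refl]]
    by (simp add: mult_2)
  obtain h where check: "reaches (length w0 + 1) (Check w0, ?x, tape_of ?w, 0)
      (if ?w = w0 then Accept else Reject, ?x, tape_of ?w, h)"
    using reaches_Check[of w0 ?x "[]" ?w] by auto
  have "reaches (total_time ?n) (Write w0, tape_of v, \<lambda>_. Blank, 0)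
      (if ?w = w0 then Accept else Reject, ?x, tape_of ?w, h)"
    unfolding total_time_def by (rule reaches_trans[OF reaches_trans[OF letters home] check])
  then show ?thesis by (intro exI conjI) auto
qed

lemma polynomial_time_total_time: "polynomial_time (\<lambda>n. total_time n + 1)"
proof -
  let ?x = "[:0, 1:] :: nat poly"
  define lt where "lt = 2 * ?x + 2 + [:U:] * (2 * (p \<circ>\<^sub>p (r \<circ>\<^sub>p (?x * [:U:]))) + 2)"
  define tt where "tt = (2 * [:length w0:] + 2) + ?x * lt + (2 * ?x + 2) + ([:length w0:] + 1) + 1"
  have "poly tt = (\<lambda>n. total_time n + 1)"
    by (rule ext) (simp add: tt_def lt_def total_time_def letter_time_def poly_pcompose mult.commute)
  then show ?thesis using polynomial_time_poly[of tt] by simp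
qed

lemma ptime_decidable_return:
  "ptime_decidable B {v \<in> lists B. fold f (concat (map u v)) w0 = w0}"
proof -
  have "decides_in_time machine B {v \<in> lists B. fold f (concat (map u v)) w0 = w0}
      (\<lambda>n. total_time n + 1)"
    by (rule decides_in_time_machine) (use reaches_verdict in auto)
  then show ?thesis
    unfolding ptime_decidable_def
    using turing_machine_machine polynomial_time_total_time by blast
qed

end

text \<open>
  Each function comes with a machine and a time bound of its own; as \<open>S\<close> and \<open>B\<close> are finite, the
  sums over them provide the uniform bounds with which the program is analysed.
\<close>

theorem ptime_decidable_fold_return:
  fixes f :: "'s \<Rightarrow> 'b list \<Rightarrow> 'b list" and r :: "nat poly"
  assumes "finite B" "finite S" "finite \<Sigma>"
    and u: "\<And>a. a \<in> B \<Longrightarrow> u a \<in> lists S"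
    and w0: "w0 \<in> lists \<Sigma>"
    and f: "\<And>s. s \<in> S \<Longrightarrow> ptime_computable \<Sigma> (f s)"
    and len: "\<And>z. z \<in> lists S \<Longrightarrow> length (fold f z w0) \<le> poly r (length z)"
  shows "ptime_decidable B {v \<in> lists B. fold f (concat (map u v)) w0 = w0}"
proof -
  have "\<exists>M p. turing_machine \<Sigma> M \<and> computes_in_time M \<Sigma> (f s) (poly p)" if s: "s \<in> S" for s
  proof -
    obtain M T where M: "turing_machine \<Sigma> M" "polynomial_time T" "computes_in_time M \<Sigma> (f s) T"
      using f[OF s] unfolding ptime_computable_def by blast
    obtain p where "\<forall>n. T n \<le> poly p n" using polynomial_time_nat_poly[OF M(2)] by blast
    then have "computes_in_time M \<Sigma> (f s) (poly p)"
      using M(3) unfolding computes_in_time_def by (meson order_trans)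
    then show ?thesis using M(1) by blast
  qed
  then obtain M p where M: "\<And>s. s \<in> S \<Longrightarrow> turing_machine \<Sigma> (M s)"
      and p: "\<And>s. s \<in> S \<Longrightarrow> computes_in_time (M s) \<Sigma> (f s) (poly (p s))"
    by metis
  have "computes_in_time (M s) \<Sigma> (f s) (poly (\<Sum>s\<in>S. p s))" if "s \<in> S" for s
  proof -
    have "poly (p s) n \<le> poly (\<Sum>s\<in>S. p s) n" for n
      unfolding poly_sum using that \<open>finite S\<close> by (intro member_le_sum) auto
    then show ?thesis
      using p[OF that] unfolding computes_in_time_def by (meson order_trans)
  qed
  moreover have "length (u a) \<le> (\<Sum>a\<in>B. length (u a))" if "a \<in> B" for a
    using that \<open>finite B\<close> by (intro member_le_sum) auto
  ultimately interpret iteration B S \<Sigma> u M f w0 "\<Sum>s\<in>S. p s" r "\<Sum>a\<in>B. length (u a)"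
    using assms M by unfold_locales (auto simp: ptime_computable_def Pi_iff simp del: in_lists_conv_set)
  show ?thesis by (rule ptime_decidable_return)
qed

section \<open>Words in a group\<close>

context group
begin

lemma word_value_Nil: "word_value G [] = \<one>"
  by (simp add: word_value_def)

lemma word_value_Cons: "word_value G (a # v) = a \<otimes> word_value G v"
  by (simp add: word_value_def)

lemma word_value_closed: "set v \<subseteq> carrier G \<Longrightarrow> word_value G v \<in> carrier G"
  by (induction v) (auto simp: word_value_Nil word_value_Cons)

lemma word_value_append:
  "set v \<subseteq> carrier G \<Longrightarrow> set w \<subseteq> carrier G \<Longrightarrow>
    word_value G (v @ w) = word_value G v \<otimes> word_value G w"
  by (induction v) (auto simp: word_value_Nil word_value_Cons word_value_closed m_assoc)

lemma word_value_concat_map: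
  "(\<And>a. a \<in> set v \<Longrightarrow> set (e a) \<subseteq> carrier G \<and> word_value G (e a) = a) \<Longrightarrow>
    word_value G (concat (map e v)) = word_value G v"
proof (induction v)
  case (Cons a v)
  have "set (concat (map e v)) \<subseteq> carrier G" using Cons.prems by auto
  then show ?case
    using Cons by (simp add: word_value_Cons word_value_append)
qed simp

lemma sym_generators_carrier: "A \<subseteq> carrier G \<Longrightarrow> sym_generators G A \<subseteq> carrier G"
  by (auto simp: sym_generators_def)

lemma generate_word:
  assumes "g \<in> generate G A" and A: "A \<subseteq> carrier G"
  shows "\<exists>v \<in> lists (sym_generators G A). word_value G v = g"
  using assms(1)
proof induction
  case one
  show ?case by (rule bexI[of _ "[]"]) (auto simp: word_value_Nil)
next
  case (incl h)
  then show ?case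
    using A by (intro bexI[of _ "[h]"]) (auto simp: word_value_Cons word_value_Nil sym_generators_def)
next
  case (inv h)
  then show ?case
    using A by (intro bexI[of _ "[inv h]"])
      (auto simp: word_value_Cons word_value_Nil sym_generators_def)
next
  case (eng g h)
  then obtain v w where "v \<in> lists (sym_generators G A)" "w \<in> lists (sym_generators G A)"
      "word_value G v = g" "word_value G w = h"
    by blast
  then show ?case
    using sym_generators_carrier[OF A]
    by (intro bexI[of _ "v @ w"]) (auto simp: word_value_append subset_iff in_lists_conv_set)
qed

text \<open>
  Replacing each element of \<open>S\<close> by a fixed word over the other generators lengthens words by at
  most a constant factor.
\<close>

lemma word_length_linear:
  assumes S: "finite S" "S \<subseteq> carrier G" and A: "finite_generators G A"
  shows "\<exists>K. \<forall>z \<in> lists S. word_length G A (word_value G z) \<le> length z * K"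
proof -
  have "\<exists>v \<in> lists (sym_generators G A). word_value G v = s" if "s \<in> S" for s
    using that S A by (intro generate_word) (auto simp: finite_generators_def)
  then obtain e where e: "\<And>s. s \<in> S \<Longrightarrow> e s \<in> lists (sym_generators G A)"
      "\<And>s. s \<in> S \<Longrightarrow> word_value G (e s) = s"
    by metis
  have carrier: "set (e s) \<subseteq> carrier G" if "s \<in> S" for s
    using e(1)[OF that] sym_generators_carrier A by (auto simp: finite_generators_def)
  let ?K = "\<Sum>s\<in>S. length (e s)"
  have "word_length G A (word_value G z) \<le> length z * ?K" if z: "z \<in> lists S" for z
  proof -
    have "word_value G (concat (map e z)) = word_value G z"
      using z e(2) carrier by (intro word_value_concat_map) auto
    moreover have "concat (map e z) \<in> lists (sym_generators G A)"
      using z e(1) by (induction z) auto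
    ultimately have "word_length G A (word_value G z) \<le> length (concat (map e z))"
      unfolding word_length_def by (intro Least_le) blast
    also have "\<dots> \<le> length z * ?K"
      using z
    proof (induction z rule: list.induct)
      case (Cons s z)
      have "s \<in> S" using Cons.prems by simp
      then have "length (e s) \<le> ?K" using S by (intro member_le_sum) auto
      then show ?case using Cons by simp
    qed simp
    finally show ?thesis .
  qed
  then show ?thesis by blast
qed

end

theorem corollary3:
  fixes G :: "('g, 'm) monoid_scheme" and A :: "'g set"
  assumes "group G"
    and "cayley_ptime_quasigeodesic G"
    and "finite_generators G A"
  shows "ptime_decidable (sym_generators G A) (word_problem G A)"
proof -
  interpret group G by fact
  obtain S A' and \<Sigma> :: "nat set" and L \<psi> where
      S: "finite_semigroup_generators G S" and A': "finite_generators G A'"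
      and rep: "cayley_ptime_representation G S \<Sigma> L \<psi>"
      and qg: "quasigeodesic_normal_form G A' L \<psi>"
    using assms(2) unfolding cayley_ptime_quasigeodesic_def by blast
  have finS: "finite S" and SG: "S \<subseteq> carrier G" using S by (auto simp: finite_semigroup_generators_def)
  have fin\<Sigma>: "finite \<Sigma>" and L: "L \<subseteq> lists \<Sigma>" and bij: "bij_betw \<psi> L (carrier G)"
    using rep by (auto simp: cayley_ptime_representation_def)
  obtain f where f: "\<And>s. s \<in> S \<Longrightarrow> ptime_computable \<Sigma> (f s)"
      "\<And>s w. s \<in> S \<Longrightarrow> w \<in> L \<Longrightarrow> f s w \<in> L \<and> \<psi> (f s w) = \<psi> w \<otimes>\<^bsub>G\<^esub> s"
    using rep unfolding cayley_ptime_representation_def image_subset_iff by metis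
  let ?B = "sym_generators G A"
  have BG: "?B \<subseteq> carrier G" and finB: "finite ?B"
    using assms(3) sym_generators_carrier by (auto simp: finite_generators_def sym_generators_def)
  have "\<exists>v \<in> lists S. word_value G v = a" if "a \<in> ?B" for a
    using S BG that unfolding finite_semigroup_generators_def by blast
  then obtain u where u: "\<And>a. a \<in> ?B \<Longrightarrow> u a \<in> lists S"
      "\<And>a. a \<in> ?B \<Longrightarrow> word_value G (u a) = a"
    by metis
  obtain w0 where w0: "w0 \<in> L" "\<psi> w0 = \<one>\<^bsub>G\<^esub>"
    using bij by (metis one_closed bij_betw_iff_bijections)
  \<comment> \<open>Applying the functions to \<open>w0\<close> along a word yields the normal form of its value.\<close>
  have iterate: "fold f z w0 \<in> L \<and> \<psi> (fold f z w0) = word_value G z" if "z \<in> lists S" for z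
    using that
  proof (induction z rule: rev_induct)
    case Nil
    then show ?case using w0 by (simp add: word_value_Nil)
  next
    case (snoc s z)
    then have "set z \<subseteq> carrier G" "s \<in> carrier G" "s \<in> S" using SG by auto
    then show ?case
      using snoc f(2) by (simp add: word_value_append word_value_Cons word_value_Nil)
  qed
  obtain C where C: "\<And>w. w \<in> L \<Longrightarrow> real (length w) \<le> C * (real (word_length G A' (\<psi> w)) + 1)"
    using qg unfolding quasigeodesic_normal_form_def by blast
  obtain K where K: "\<And>z. z \<in> lists S \<Longrightarrow> word_length G A' (word_value G z) \<le> length z * K"
    using word_length_linear[OF finS SG A'] by blast
  let ?C = "nat \<lceil>\<bar>C\<bar>\<rceil>"
  have len: "length (fold f z w0) \<le> poly [:?C, ?C * K:] (length z)" if z: "z \<in> lists S" for z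
  proof -
    let ?d = "word_length G A' (word_value G z)"
    have "real (length (fold f z w0)) \<le> C * (real ?d + 1)"
      using C iterate[OF z] by metis
    also have "\<dots> \<le> real ?C * (real ?d + 1)"
      by (intro mult_right_mono) linarith+
    also have "\<dots> = real (?C * (?d + 1))" by (simp add: distrib_left)
    finally have "length (fold f z w0) \<le> ?C * (?d + 1)" by (simp only: of_nat_le_iff)
    also have "\<dots> \<le> ?C * (length z * K + 1)" using K[OF z] by (intro mult_left_mono) auto
    finally show ?thesis by (simp add: algebra_simps)
  qed
  \<comment> \<open>Both sides say that \<open>\<psi>\<close> maps the final word to the identity, by injectivity of \<open>\<psi>\<close> on \<open>L\<close>.\<close>
  have "word_problem G A = {v \<in> lists ?B. fold f (concat (map u v)) w0 = w0}"
    unfolding word_problem_def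
  proof (intro Collect_cong conj_cong refl)
    fix v assume v: "v \<in> lists ?B"
    let ?z = "concat (map u v)"
    have z: "?z \<in> lists S" using v u(1) by (induction v) auto
    have "word_value G ?z = word_value G v"
    proof (rule word_value_concat_map)
      fix a assume "a \<in> set v"
      then have "a \<in> ?B" using v by auto
      then show "set (u a) \<subseteq> carrier G \<and> word_value G (u a) = a" using u[of a] SG by auto
    qed
    then show "word_value G v = \<one>\<^bsub>G\<^esub> \<longleftrightarrow> fold f ?z w0 = w0"
      using iterate[OF z] w0 bij by (metis bij_betw_def inj_on_eq_iff)
  qed
  moreover have "w0 \<in> lists \<Sigma>" using w0(1) L by blast
  ultimately show ?thesis
    using ptime_decidable_fold_return[OF finB finS fin\<Sigma>, of u w0 f "[:?C, ?C * K:]"] u(1) f(1) len by simp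
qed

end
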